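(* Let $\tau\in\mathbb{C}$ with $\operatorname{Im}\tau>0$, and let $X_{\tau,u}=\big(\mathbb{C}/(\mathbb{Z}+\tau\mathbb{Z})\big)\setminus\{u\}$ be a once-punctured complex torus. The Gaussian curvature of the fundamental metric on $X_{\tau,u}$ cannot be bounded from above by a negative constant; that is, there is no constant $C<0$ such that the Gaussian curvature is $\le C$ at every point of $X_{\tau,u}$.
   Context: Points are written in the coordinate induced from $\mathbb{C}$, i.e. $z,w,u$ also denote complex numbers representing them. Evans-Selberg potential: on an open Riemann surface $\Sigma$, an Evans-Selberg potential with pole $q\in\Sigma$ is a real-valued function $E_q(p)$ such that (i) $E_q$ is harmonic on $\Sigma\setminus\{q\}$; (ii) $E_q(p)\to+\infty$ as $p$ tends to the Alexandroff ideal boundary point $a_\infty$; (iii) $E_q(p)-\log|\varphi(p)-\varphi(q)|$ is bounded near $q$, with $\varphi$ a local coordinate. Fundamental metric: in the local coordinate $z=\varphi(p)$ it is $c(z)|dz|^2:=\exp\lim_{q\to p}\big(E_q(p)-\log|\varphi(p)-\varphi(q)|\big)|dz|^2$. On $X_{\tau,u}$ the potential with pole $w$ used to form the fundamental metric is $$E^{\tau,u}_w(z)=\log\left|\frac{\theta_1(z-w;q)}{\theta_1(z-u;q)}\right|,$$ where $q=\exp(\pi i\tau)$, $q^{1/4}=\exp(\pi i\tau/4)$ and $\theta_1(z;q)=2q^{1/4}\sin(\pi z)\prod_{n=1}^\infty(1-q^{2n})(1-2\cos(2\pi z)q^{2n}+q^{4n})$; thus the fundamental metric has coefficient $c_{\tau,u}(w)=\exp\lim_{z\to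 w}\big(E^{\tau,u}_w(z)-\log|z-w|\big)$. Gaussian curvature: the curvature form of the fundamental metric with coefficient $c$ is $-4\,\frac{\partial^2}{\partial z\,\partial\bar z}\log c(z)$, and the Gaussian curvature is this quantity divided by $c(z)^2$ (the convention in which the Suita metric of a hyperbolic surface has curvature $\le -4$). *)

theory Defs
  imports "HOL-Complex_Analysis.Complex_Analysis"
begin

definition torus_rel :: "complex \<Rightarrow> (complex \<times> complex) set" where
  "torus_rel \<tau> = {(z, w). \<exists>m n :: int. z - w = of_int m + of_int n * \<tau>}"

definition torus :: "complex \<Rightarrow> complex set set" where
  "torus \<tau> = UNIV // torus_rel \<tau>"

definition punctured_torus :: "complex \<Rightarrow> complex \<Rightarrow> complex set set" where
  "punctured_torus \<tau> u = torus \<tau> - {torus_rel \<tau> `` {u}}"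

definition nome :: "complex \<Rightarrow> complex" where
  "nome \<tau> = exp (of_real pi * \<i> * \<tau>)"

text \<open>
  The first argument is \<open>\<tau>\<close> and not the nome \<open>q\<close>, because the branch of \<open>q\<^sup>1\<^sup>/\<^sup>4\<close> is fixed
  as \<open>exp (\<pi> \<i> \<tau> / 4)\<close>. \<^const>\<open>prodinf\<close> starts at 0, hence the index \<open>Suc n\<close>.
\<close>
definition theta1 :: "complex \<Rightarrow> complex \<Rightarrow> complex" where
  "theta1 \<tau> z = 2 * exp (of_real pi * \<i> * \<tau> / 4) * sin (of_real pi * z) *
     (\<Prod>n. (1 - nome \<tau> ^ (2 * Suc n)) *
          (1 - 2 * cos (2 * of_real pi * z) * nome \<tau> ^ (2 * Suc n) + nome \<tau> ^ (4 * Suc n)))"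

text \<open>
  The potential with pole \<open>w\<close>. Its arguments are complex numbers representing points of the
  torus: \<open>theta1 \<tau> (z + \<tau>) = - exp (- \<pi> \<i> \<tau> - 2 \<pi> \<i> z) * theta1 \<tau> z\<close>, so the potential is invariant
  under translations by 1 but in general not under translations by \<open>\<tau>\<close>.
\<close>
definition evans_selberg :: "complex \<Rightarrow> complex \<Rightarrow> complex \<Rightarrow> complex \<Rightarrow> real" where
  "evans_selberg \<tau> u w z = ln (cmod (theta1 \<tau> (z - w) / theta1 \<tau> (z - u)))"

definition fundamental_coeff :: "(complex \<Rightarrow> complex \<Rightarrow> real) \<Rightarrow> complex \<Rightarrow> real" where
  "fundamental_coeff E w = exp (Lim (at w) (\<lambda>z. E w z - ln (cmod (z - w))))"

definition partial_x :: "(complex \<Rightarrow> complex) \<Rightarrow> complex \<Rightarrow> complex" where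
  "partial_x f z = vector_derivative (\<lambda>t::real. f (z + of_real t)) (at 0)"

definition partial_y :: "(complex \<Rightarrow> complex) \<Rightarrow> complex \<Rightarrow> complex" where
  "partial_y f z = vector_derivative (\<lambda>t::real. f (z + \<i> * of_real t)) (at 0)"

definition wirtinger :: "(complex \<Rightarrow> complex) \<Rightarrow> complex \<Rightarrow> complex" where
  "wirtinger f z = (partial_x f z - \<i> * partial_y f z) / 2"

definition wirtinger_bar :: "(complex \<Rightarrow> complex) \<Rightarrow> complex \<Rightarrow> complex" where
  "wirtinger_bar f z = (partial_x f z + \<i> * partial_y f z) / 2"

text \<open>
  The metric with coefficient \<open>c\<close> is normalised so that \<open>c\<close> is the length element: the curvature
  form is divided by the square of \<open>c\<close>. The mixed derivative of the real function \<open>ln \<circ> c\<close> is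
  real wherever that function is twice continuously differentiable; \<^const>\<open>Re\<close> only changes the
  type.
\<close>
definition gaussian_curvature :: "(complex \<Rightarrow> real) \<Rightarrow> complex \<Rightarrow> real" where
  "gaussian_curvature c z =
     - 4 * Re (wirtinger (wirtinger_bar (\<lambda>w. of_real (ln (c w)))) z) / (c z)\<^sup>2"

end

theory Submission imports Defs begin

text \<open>
  The fundamental metric is flat. Since \<open>theta1 \<tau>\<close> is entire with a simple zero at the origin, the
  limit that defines the coefficient can be computed outright:
  \<open>c w = \<bar>theta1' 0\<bar> / \<bar>theta1 (w - u)\<bar>\<close> at every point \<open>w\<close> outside \<open>u + \<int> + \<tau>\<int>\<close>
  (lemma \<open>fundamental_coeff_evans_selberg\<close>). Locally \<open>theta1 (w - u) = exp (g w)\<close> with \<open>g\<close>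
  holomorphic, so \<open>ln c\<close> is a constant minus \<open>Re g\<close>. This is a harmonic function, and its mixed
  derivative vanishes (lemma \<open>gaussian_curvature_const_over_holomorphic\<close>). Hence the curvature
  is \<open>0\<close> on the whole punctured torus, and a negative upper bound fails at any point, for instance
  at the class of \<open>u + 1/2\<close>.

  What has to be known about \<open>theta1\<close> is that it is entire, that it does not vanish off the
  lattice, and that its derivative at \<open>0\<close> is not \<open>0\<close>. All three come from the infinite product: its
  factors differ from \<open>1\<close> by at most a multiple of \<open>\<bar>q\<bar> ^ n\<close>, where \<open>q = nome \<tau>\<close>, locally uniformly in \<open>z\<close>, so
  the product is entire and vanishes only where one of its factors does.
\<close>

section \<open>Metrics with a holomorphic potential are flat\<close>

lemma partial_x_eq:
  assumes "(F has_derivative D) (at z)"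
  shows "partial_x F z = D 1"
proof -
  have "((\<lambda>t::real. z + of_real t) has_vector_derivative 1) (at 0)"
    by (auto intro!: derivative_eq_intros simp: has_vector_derivative_def scaleR_conv_of_real)
  then have "((F \<circ> (\<lambda>t::real. z + of_real t)) has_vector_derivative D 1) (at 0)"
    by (rule vector_derivative_diff_chain_within)
       (use assms in \<open>auto intro: has_derivative_at_withinI\<close>)
  then show ?thesis
    by (simp add: partial_x_def o_def vector_derivative_at)
qed

lemma partial_y_eq:
  assumes "(F has_derivative D) (at z)"
  shows "partial_y F z = D \<i>"
proof -
  have "((\<lambda>t::real. z + \<i> * of_real t) has_vector_derivative \<i>) (at 0)"
    by (auto intro!: derivative_eq_intros simp: has_vector_derivative_def scaleR_conv_of_real)
  then have "((F \<circ> (\<lambda>t::real. z + \<i> * of_real t)) has_vector_derivative D \<i>) (at 0)"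
    by (rule vector_derivative_diff_chain_within)
       (use assms in \<open>auto intro: has_derivative_at_withinI\<close>)
  then show ?thesis
    by (simp add: partial_y_def o_def vector_derivative_at)
qed

text \<open>
  Up to a constant the function is \<open>-Re g\<close>, that is, half of the sum of \<open>-g\<close> and \<open>-cnj g\<close>; only the
  second summand has a derivative with respect to the conjugate variable.
\<close>

lemma wirtinger_bar_Re_holomorphic:
  assumes "open S" "z \<in> S" and g: "g holomorphic_on S"
    and F: "\<And>w. w \<in> S \<Longrightarrow> F w = of_real (a - Re (g w))"
  shows "wirtinger_bar F z = - cnj (deriv g z) / 2"
proof -
  have "(g has_derivative (*) (deriv g z)) (at z)"
    using holomorphic_derivI[OF g assms(1,2)] by (simp add: has_field_derivative_def)
  then have "((\<lambda>w. complex_of_real (a - Re (g w))) has_derivative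
      (\<lambda>h. - of_real (Re (deriv g z * h)))) (at z)"
    by (auto intro!: derivative_eq_intros)
  then have "(F has_derivative (\<lambda>h. - of_real (Re (deriv g z * h)))) (at z)"
    by (rule has_derivative_transform_within_open[OF _ assms(1,2)]) (simp add: F)
  from partial_x_eq[OF this] partial_y_eq[OF this] show ?thesis
    by (simp add: wirtinger_bar_def complex_eq_iff)
qed

lemma wirtinger_cnj_holomorphic:
  assumes "open S" "z \<in> S" and h: "h holomorphic_on S"
    and F: "\<And>w. w \<in> S \<Longrightarrow> F w = cnj (h w)"
  shows "wirtinger F z = 0"
proof -
  have "(h has_derivative (*) (deriv h z)) (at z)"
    using holomorphic_derivI[OF h assms(1,2)] by (simp add: has_field_derivative_def)
  then have "((\<lambda>w. cnj (h w)) has_derivative (\<lambda>k. cnj (deriv h z * k))) (at z)"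
    by (rule has_derivative_cnj)
  then have "(F has_derivative (\<lambda>k. cnj (deriv h z * k))) (at z)"
    by (rule has_derivative_transform_within_open[OF _ assms(1,2)]) (simp add: F)
  from partial_x_eq[OF this] partial_y_eq[OF this] show ?thesis
    by (simp add: wirtinger_def complex_eq_iff)
qed

text \<open>
  On a disc around the given point \<open>f\<close> has a holomorphic logarithm \<open>g\<close>, and then
  \<open>ln c = ln a - Re g\<close> is harmonic.
\<close>

lemma gaussian_curvature_const_over_holomorphic:
  assumes "open S" "z \<in> S" and f: "f holomorphic_on S"
    and nz: "\<And>w. w \<in> S \<Longrightarrow> f w \<noteq> 0"
    and "a > 0" and c: "\<And>w. w \<in> S \<Longrightarrow> c w = a / cmod (f w)"
  shows "gaussian_curvature c z = 0"
proof -
  obtain r where r: "r > 0" "ball z r \<subseteq> S"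
    using assms(1,2) openE by blast
  have "f holomorphic_on ball z r" "contractible (ball z r)"
    using holomorphic_on_subset[OF f r(2)] by (auto intro: convex_imp_contractible)
  then obtain g where g: "g holomorphic_on ball z r"
      and fg: "\<And>w. w \<in> ball z r \<Longrightarrow> f w = exp (g w)"
    by (rule contractible_imp_holomorphic_log) (use nz r in auto)
  have "ln (c w) = ln a - Re (g w)" if "w \<in> ball z r" for w
    using that r \<open>a > 0\<close> by (simp add: c[OF subsetD[OF r(2) that]] fg ln_div)
  then have "wirtinger_bar (\<lambda>w. of_real (ln (c w))) w = cnj (- deriv g w / 2)"
    if "w \<in> ball z r" for w
    using wirtinger_bar_Re_holomorphic[OF open_ball that g, of "\<lambda>w. of_real (ln (c w))" "ln a"]
    by simp
  moreover have "(\<lambda>w. - deriv g w / 2) holomorphic_on ball z r"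
    using g by (intro holomorphic_intros) auto
  ultimately have "wirtinger (wirtinger_bar (\<lambda>w. of_real (ln (c w)))) z = 0"
    using r(1) by (intro wirtinger_cnj_holomorphic[of "ball z r"]) auto
  then show ?thesis
    by (simp add: gaussian_curvature_def)
qed

section \<open>The theta function\<close>

definition theta_factor :: "complex \<Rightarrow> nat \<Rightarrow> complex \<Rightarrow> complex" where
  "theta_factor \<tau> n z = (1 - nome \<tau> ^ (2 * Suc n)) *
     (1 - 2 * cos (2 * of_real pi * z) * nome \<tau> ^ (2 * Suc n) + nome \<tau> ^ (4 * Suc n))"

lemma theta1_eq:
  "theta1 \<tau> z = 2 * exp (of_real pi * \<i> * \<tau> / 4) * sin (of_real pi * z) * (\<Prod>n. theta_factor \<tau> n z)"
  by (simp add: theta1_def theta_factor_def)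

lemma norm_nome_less_1: "Im \<tau> > 0 \<Longrightarrow> norm (nome \<tau>) < 1"
  by (simp add: nome_def)

lemma holomorphic_theta_factor: "theta_factor \<tau> n holomorphic_on S"
  unfolding theta_factor_def by (intro holomorphic_intros)

lemma norm_theta_factor_minus_1_le:
  assumes "Im \<tau> > 0"
  shows "norm (theta_factor \<tau> n z - 1) \<le>
    (4 * norm (cos (2 * of_real pi * z)) + 3) * norm (nome \<tau>) ^ n"
proof -
  define a where "a = nome \<tau> ^ (2 * Suc n)"
  define k where "k = cos (2 * of_real pi * z)"
  have a2: "nome \<tau> ^ (4 * Suc n) = a\<^sup>2"
    unfolding a_def power_mult[symmetric] by (rule arg_cong[of _ _ "power (nome \<tau>)"]) simp
  have a1: "norm a \<le> 1" and an: "norm a \<le> norm (nome \<tau>) ^ n"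
    using norm_nome_less_1[OF assms] unfolding a_def norm_power
    by (intro power_le_one power_decreasing; simp)+
  have "theta_factor \<tau> n z - 1 = a * (2 * k * a - 2 * k + a - 1 - a * a)"
    by (simp only: theta_factor_def a2 flip: a_def k_def) (simp add: algebra_simps power2_eq_square)
  also have "norm \<dots> \<le> norm a * (4 * norm k + 3)"
  proof -
    have "norm (2 * k * a) \<le> 2 * norm k" "norm (a * a) \<le> 1"
      using a1 by (auto simp: norm_mult mult_left_le mult_le_one)
    then have "norm (2 * k * a - 2 * k + a - 1 - a * a) \<le> 4 * norm k + 3"
      using a1 norm_triangle_ineq4[of "2 * k * a - 2 * k + a - 1" "a * a"]
        norm_triangle_ineq4[of "2 * k * a - 2 * k + a" 1]
        norm_triangle_ineq[of "2 * k * a - 2 * k" a]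
        norm_triangle_ineq4[of "2 * k * a" "2 * k"] by (simp add: norm_mult)
    then show ?thesis
      by (simp add: norm_mult mult_left_mono)
  qed
  also have "\<dots> \<le> norm (nome \<tau>) ^ n * (4 * norm k + 3)"
    using an by (intro mult_right_mono) auto
  finally show ?thesis
    by (simp add: k_def mult.commute)
qed

lemma convergent_prod_theta_factor:
  assumes "Im \<tau> > 0"
  shows "convergent_prod (\<lambda>n. theta_factor \<tau> n z)"
proof -
  have "summable (\<lambda>n. norm (theta_factor \<tau> n z - 1))"
  proof (rule summable_comparison_test')
    show "summable (\<lambda>n. (4 * norm (cos (2 * of_real pi * z)) + 3) * norm (nome \<tau>) ^ n)"
      using norm_nome_less_1[OF assms] by (intro summable_mult summable_geometric) auto
  qed (use norm_theta_factor_minus_1_le[OF assms] in auto)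
  then show ?thesis
    by (intro abs_convergent_prod_imp_convergent_prod summable_imp_abs_convergent_prod)
qed

lemma holomorphic_theta_product:
  assumes "Im \<tau> > 0"
  shows "(\<lambda>z. \<Prod>n. theta_factor \<tau> n z) holomorphic_on UNIV"
proof (rule holomorphic_uniform_sequence)
  show "(\<lambda>z. \<Prod>k<n. theta_factor \<tau> k z) holomorphic_on UNIV" for n
    by (intro holomorphic_intros holomorphic_theta_factor)
next
  fix x :: complex
  have "bounded ((\<lambda>z. cos (2 * of_real pi * z)) ` cball x 1)"
    by (intro compact_imp_bounded compact_continuous_image continuous_intros compact_cball)
  then obtain B where B: "\<And>z. z \<in> cball x 1 \<Longrightarrow> norm (cos (2 * of_real pi * z)) \<le> B"
    unfolding bounded_iff by blast
  have "uniformly_convergent_on (cball x 1) (\<lambda>N z. \<Sum>n<N. norm (theta_factor \<tau> n z - 1))"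
  proof (rule Weierstrass_m_test')
    show "norm (norm (theta_factor \<tau> n z - 1)) \<le> (4 * B + 3) * norm (nome \<tau>) ^ n"
      if "z \<in> cball x 1" for n z
    proof -
      have "(4 * norm (cos (2 * of_real pi * z)) + 3) * norm (nome \<tau>) ^ n
          \<le> (4 * B + 3) * norm (nome \<tau>) ^ n"
        using B[OF that] by (intro mult_right_mono) auto
      then show ?thesis
        using norm_theta_factor_minus_1_le[OF assms, of n z] by simp
    qed
    show "summable (\<lambda>n. (4 * B + 3) * norm (nome \<tau>) ^ n)"
      using norm_nome_less_1[OF assms] by (intro summable_mult summable_geometric) auto
  qed
  then have "uniformly_convergent_on (cball x 1) (\<lambda>N z. \<Prod>n<N. theta_factor \<tau> n z)"
    by (intro uniformly_convergent_on_prod' holomorphic_on_imp_continuous_on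
          holomorphic_theta_factor compact_cball)
  then have "uniform_limit (cball x 1) (\<lambda>N z. \<Prod>n<N. theta_factor \<tau> n z)
      (\<lambda>z. lim (\<lambda>N. \<Prod>n<N. theta_factor \<tau> n z)) sequentially"
    by (simp add: uniformly_convergent_uniform_limit_iff)
  moreover have "lim (\<lambda>N. \<Prod>n<N. theta_factor \<tau> n z) = (\<Prod>n. theta_factor \<tau> n z)" for z
    by (intro limI has_prod_imp_tendsto' convergent_prod_has_prod
          convergent_prod_theta_factor assms)
  ultimately have "uniform_limit (cball x 1) (\<lambda>N z. \<Prod>n<N. theta_factor \<tau> n z)
      (\<lambda>z. \<Prod>n. theta_factor \<tau> n z) sequentially"
    by simp
  then show "\<exists>d>0. cball x d \<subseteq> UNIV \<and> uniform_limit (cball x d)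
      (\<lambda>N z. \<Prod>n<N. theta_factor \<tau> n z) (\<lambda>z. \<Prod>n. theta_factor \<tau> n z) sequentially"
    by (intro exI[of _ 1]) auto
qed auto

lemma holomorphic_theta1:
  assumes "Im \<tau> > 0"
  shows "theta1 \<tau> holomorphic_on S"
proof -
  have "theta1 \<tau> holomorphic_on UNIV"
    unfolding theta1_eq[abs_def] by (intro holomorphic_intros holomorphic_theta_product assms)
  then show ?thesis
    by (rule holomorphic_on_subset) simp
qed

lemma exp_2pi_eq_1D:
  assumes "exp (2 * of_real pi * \<i> * z) = 1"
  obtains k :: int where "z = of_int k"
proof -
  obtain k :: int where "2 * of_real pi * \<i> * z = 2 * of_real pi * \<i> * of_int k"
    using assms exp_eq[of "2 * of_real pi * \<i> * z" 0] by (auto simp: mult_ac)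
  then have "z = of_int k"
    by simp
  then show ?thesis
    by (rule that)
qed

text \<open>
  With \<open>a = nome \<tau> ^ (2 * Suc n)\<close> and \<open>e = exp (2 \<pi> \<i> z)\<close> the second part of the factor is
  \<open>(1 - a * e) * (1 - a / e)\<close>, where \<open>a * e\<close> and \<open>a / e\<close> are the values of \<open>exp (2 \<pi> \<i> x)\<close> at
  \<open>x = Suc n * \<tau> + z\<close> and \<open>x = Suc n * \<tau> - z\<close>. The first part does not vanish as \<open>\<bar>a\<bar> < 1\<close>.
\<close>

lemma theta_factor_eq_0D:
  assumes "Im \<tau> > 0" and "theta_factor \<tau> n z = 0"
  obtains k :: int and s :: complex
    where "s = 1 \<or> s = - 1" and "of_nat (Suc n) * \<tau> + s * z = of_int k"
proof -
  define a where "a = nome \<tau> ^ (2 * Suc n)"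
  define e where "e = exp (2 * of_real pi * \<i> * z)"
  define e' where "e' = exp (- (2 * of_real pi * \<i> * z))"
  have aexp: "a = exp (2 * of_real pi * \<i> * (of_nat (Suc n) * \<tau>))"
    unfolding a_def nome_def exp_of_nat_mult[symmetric] by (simp add: algebra_simps)
  have a2: "nome \<tau> ^ (4 * Suc n) = a\<^sup>2"
    unfolding a_def power_mult[symmetric] by (rule arg_cong[of _ _ "power (nome \<tau>)"]) simp
  have cos2: "2 * cos (2 * of_real pi * z) = e + e'"
    by (simp add: cos_exp_eq e_def e'_def mult_ac)
  have ee: "e * e' = 1"
    by (simp add: e_def e'_def flip: exp_add)
  have "norm a \<le> norm (nome \<tau>) ^ 1"
    using norm_nome_less_1[OF assms(1)] unfolding a_def norm_power
    by (intro power_decreasing) auto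
  then have "norm a < 1"
    using norm_nome_less_1[OF assms(1)] by simp
  then have "a \<noteq> 1"
    by auto
  have "theta_factor \<tau> n z = (1 - a) * (1 - (e + e') * a + a\<^sup>2)"
    by (simp only: theta_factor_def a2 cos2 flip: a_def)
  also have "1 - (e + e') * a + a\<^sup>2 = (1 - a * e) * (1 - a * e')"
    using ee by algebra
  finally have "a * e = 1 \<or> a * e' = 1"
    using assms(2) \<open>a \<noteq> 1\<close> by auto
  then show ?thesis
  proof
    assume "a * e = 1"
    then have "exp (2 * of_real pi * \<i> * (of_nat (Suc n) * \<tau> + z)) = 1"
      by (simp only: aexp e_def distrib_left exp_add)
    then show ?thesis
      by (rule exp_2pi_eq_1D) (use that[of 1] in auto)
  next
    assume "a * e' = 1"
    then have "exp (2 * of_real pi * \<i> * (of_nat (Suc n) * \<tau> - z)) = 1"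
      by (simp only: aexp e'_def right_diff_distrib flip: exp_add diff_conv_add_uminus)
    then show ?thesis
      by (rule exp_2pi_eq_1D) (use that[of "- 1"] in auto)
  qed
qed

lemma theta1_nonzero:
  assumes "Im \<tau> > 0" and "(z, 0) \<notin> torus_rel \<tau>"
  shows "theta1 \<tau> z \<noteq> 0"
proof -
  have nl: "z \<noteq> of_int m + of_int n * \<tau>" for m n :: int
    using assms(2) by (auto simp: torus_rel_def)
  have "theta_factor \<tau> n z \<noteq> 0" for n
  proof
    assume "theta_factor \<tau> n z = 0"
    with assms(1) obtain k :: int and s :: complex
      where "s = 1 \<or> s = - 1" "of_nat (Suc n) * \<tau> + s * z = of_int k"
      by (rule theta_factor_eq_0D)
    then have "z = of_int k + of_int (- int (Suc n)) * \<tau> \<or>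
        z = of_int (- k) + of_int (int (Suc n)) * \<tau>"
      by (auto simp: algebra_simps)
    with nl show False
      by blast
  qed
  then have "(\<Prod>n. theta_factor \<tau> n z) \<noteq> 0"
    by (intro prodinf_nonzero convergent_prod_theta_factor assms)
  moreover have "sin (of_real pi * z) \<noteq> 0"
    using nl[of _ 0] by (auto simp: sin_eq_0 mult.commute)
  ultimately show ?thesis
    by (simp add: theta1_eq)
qed

text \<open>
  The sine has a simple zero at \<open>0\<close>. The product does not vanish there: a factor could do so only if
  a positive multiple of \<open>\<tau>\<close> were an integer.
\<close>

lemma deriv_theta1_0_nonzero:
  assumes "Im \<tau> > 0"
  shows "deriv (theta1 \<tau>) 0 \<noteq> 0"
proof -
  define P where "P z = (\<Prod>n. theta_factor \<tau> n z)" for z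
  define A where "A = 2 * exp (of_real pi * \<i> * \<tau> / 4)"
  have "theta_factor \<tau> n 0 \<noteq> 0" for n
  proof
    assume "theta_factor \<tau> n 0 = 0"
    with assms obtain k :: int and s :: complex
      where "of_nat (Suc n) * \<tau> + s * 0 = of_int k"
      by (rule theta_factor_eq_0D)
    from arg_cong[OF this, of Im] show False
      using assms by (simp del: of_nat_Suc)
  qed
  then have "P 0 \<noteq> 0"
    unfolding P_def by (intro prodinf_nonzero convergent_prod_theta_factor assms)
  have "(P has_field_derivative deriv P 0) (at 0)"
    using holomorphic_theta_product[OF assms] unfolding P_def[abs_def]
    by (intro holomorphic_derivI[of _ UNIV]) auto
  then have "((\<lambda>z. A * sin (of_real pi * z) * P z) has_field_derivative A * of_real pi * P 0) (at 0)"
    by (auto intro!: derivative_eq_intros)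
  moreover have "theta1 \<tau> = (\<lambda>z. A * sin (of_real pi * z) * P z)"
    by (auto simp: theta1_eq A_def P_def)
  ultimately have "deriv (theta1 \<tau>) 0 = A * of_real pi * P 0"
    by (simp add: DERIV_imp_deriv)
  with \<open>P 0 \<noteq> 0\<close> show ?thesis
    by (simp add: A_def)
qed

section \<open>The fundamental metric\<close>

lemma fundamental_coeff_evans_selberg:
  assumes "Im \<tau> > 0" and nz: "theta1 \<tau> (w - u) \<noteq> 0"
  shows "fundamental_coeff (evans_selberg \<tau> u) w =
    cmod (deriv (theta1 \<tau>) 0) / cmod (theta1 \<tau> (w - u))"
proof -
  define d where "d = deriv (theta1 \<tau>) 0"
  have d: "d \<noteq> 0"
    unfolding d_def by (rule deriv_theta1_0_nonzero[OF assms(1)])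
  have "(theta1 \<tau> has_field_derivative d) (at 0)"
    unfolding d_def using holomorphic_theta1[OF assms(1)] by (intro holomorphic_derivI[of _ UNIV]) auto
  then have "((\<lambda>h. theta1 \<tau> h / h) \<longlongrightarrow> d) (at 0)"
    by (simp add: DERIV_def theta1_eq)
  then have num: "((\<lambda>z. theta1 \<tau> (z - w) / (z - w)) \<longlongrightarrow> d) (at w)"
    by (subst LIM_offset_zero_iff) auto
  have "continuous_on UNIV (theta1 \<tau>)"
    by (intro holomorphic_on_imp_continuous_on holomorphic_theta1 assms)
  then have "isCont (\<lambda>z. theta1 \<tau> (z - u)) w"
    by (intro continuous_intros isCont_o2[of _ "\<lambda>z. z - u" "theta1 \<tau>"])
       (auto simp: continuous_on_eq_continuous_at)
  then have den: "((\<lambda>z. theta1 \<tau> (z - u)) \<longlongrightarrow> theta1 \<tau> (w - u)) (at w)"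
    by (simp add: isCont_def)
  have "((\<lambda>z. ln (cmod (theta1 \<tau> (z - w) / (z - w)) / cmod (theta1 \<tau> (z - u)))) \<longlongrightarrow>
      ln (cmod d / cmod (theta1 \<tau> (w - u)))) (at w)"
    using d nz by (intro tendsto_intros num den) auto
  moreover have "\<forall>\<^sub>F z in at w.
      ln (cmod (theta1 \<tau> (z - w) / (z - w)) / cmod (theta1 \<tau> (z - u))) =
      evans_selberg \<tau> u w z - ln (cmod (z - w))"
    using tendsto_imp_eventually_ne[OF num d] tendsto_imp_eventually_ne[OF den nz]
    by eventually_elim (auto simp: evans_selberg_def norm_divide ln_div ln_mult)
  ultimately have "((\<lambda>z. evans_selberg \<tau> u w z - ln (cmod (z - w))) \<longlongrightarrow>
      ln (cmod d / cmod (theta1 \<tau> (w - u)))) (at w)"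
    by (rule Lim_transform_eventually)
  then have "Lim (at w) (\<lambda>z. evans_selberg \<tau> u w z - ln (cmod (z - w))) =
      ln (cmod d / cmod (theta1 \<tau> (w - u)))"
    by (rule tendsto_Lim[rotated]) simp
  then show ?thesis
    using d nz by (simp add: fundamental_coeff_def d_def)
qed

lemma gaussian_curvature_fundamental_metric:
  assumes "Im \<tau> > 0" and "(w, u) \<notin> torus_rel \<tau>"
  shows "gaussian_curvature (fundamental_coeff (evans_selberg \<tau> u)) w = 0"
proof (rule gaussian_curvature_const_over_holomorphic)
  let ?S = "(\<lambda>z. theta1 \<tau> (z - u)) -` (- {0})"
  have hol: "(\<lambda>z. theta1 \<tau> (z - u)) holomorphic_on S" for S
    using holomorphic_on_compose[OF holomorphic_on_diff[OF holomorphic_on_ident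
          holomorphic_on_const] holomorphic_theta1[OF assms(1)], of u S]
    by (simp add: o_def)
  then show "(\<lambda>z. theta1 \<tau> (z - u)) holomorphic_on ?S" .
  show "open ?S"
    using hol[of UNIV] by (intro open_vimage holomorphic_on_imp_continuous_on) auto
  show "w \<in> ?S"
    using assms theta1_nonzero[of \<tau> "w - u"] by (auto simp: torus_rel_def)
  show "cmod (deriv (theta1 \<tau>) 0) > 0"
    using deriv_theta1_0_nonzero[OF assms(1)] by simp
  show "fundamental_coeff (evans_selberg \<tau> u) z =
      cmod (deriv (theta1 \<tau>) 0) / cmod (theta1 \<tau> (z - u))" if "z \<in> ?S" for z
    using that by (intro fundamental_coeff_evans_selberg assms) auto
qed auto

lemma equiv_torus_rel: "equiv UNIV (torus_rel \<tau>)"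
proof (rule equivI)
  show "refl (torus_rel \<tau>)"
    by (auto simp: refl_on_def torus_rel_def intro!: exI[of _ 0])
  show "sym (torus_rel \<tau>)"
  proof (rule symI)
    fix z w assume "(z, w) \<in> torus_rel \<tau>"
    then obtain m n :: int where "z - w = of_int m + of_int n * \<tau>"
      by (auto simp: torus_rel_def)
    then have "w - z = of_int (- m) + of_int (- n) * \<tau>"
      by (simp add: algebra_simps)
    then show "(w, z) \<in> torus_rel \<tau>"
      unfolding torus_rel_def by blast
  qed
  show "trans (torus_rel \<tau>)"
  proof (rule transI)
    fix x y z assume "(x, y) \<in> torus_rel \<tau>" "(y, z) \<in> torus_rel \<tau>"
    then obtain m n m' n' :: int
      where "x - y = of_int m + of_int n * \<tau>" "y - z = of_int m' + of_int n' * \<tau>"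
      by (auto simp: torus_rel_def)
    then have "x - z = of_int (m + m') + of_int (n + n') * \<tau>"
      by (simp add: algebra_simps)
    then show "(x, z) \<in> torus_rel \<tau>"
      unfolding torus_rel_def by blast
  qed
qed auto

lemma half_notin_lattice:
  assumes "Im \<tau> > 0"
  shows "(u + 1 / 2, u) \<notin> torus_rel \<tau>"
proof
  assume "(u + 1 / 2, u) \<in> torus_rel \<tau>"
  then obtain m n :: int where mn: "1 / 2 = of_int m + of_int n * \<tau>"
    by (auto simp: torus_rel_def)
  from arg_cong[OF mn, of Im] assms have "n = 0"
    by simp
  with arg_cong[OF mn, of Re] have "of_int (2 * m) = (1 :: real)"
    by simp
  then have "2 * m = 1"
    by linarith
  then show False
    by presburger
qed

theorem corollary1p3:
  fixes \<tau> u :: complex and rep :: "complex set \<Rightarrow> complex"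
  assumes "Im \<tau> > 0"
    and "\<And>p. p \<in> punctured_torus \<tau> u \<Longrightarrow> rep p \<in> p"
  shows "\<not> (\<exists>C::real. C < 0 \<and>
           (\<forall>p\<in>punctured_torus \<tau> u.
              gaussian_curvature (fundamental_coeff (evans_selberg \<tau> u)) (rep p) \<le> C))"
proof -
  define p where "p = torus_rel \<tau> `` {u + 1 / 2}"
  have "p \<noteq> torus_rel \<tau> `` {u}"
    using half_notin_lattice[OF assms(1)] eq_equiv_class[OF _ equiv_torus_rel] by (auto simp: p_def)
  then have p: "p \<in> punctured_torus \<tau> u"
    by (auto simp: punctured_torus_def torus_def p_def quotientI)
  then have "(u + 1 / 2, rep p) \<in> torus_rel \<tau>"
    using assms(2)[OF p] by (simp add: p_def)
  then have "(rep p, u) \<notin> torus_rel \<tau>"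
    using half_notin_lattice[OF assms(1)] equiv_torus_rel
    by (meson equivE transE)
  then have "gaussian_curvature (fundamental_coeff (evans_selberg \<tau> u)) (rep p) = 0"
    by (rule gaussian_curvature_fundamental_metric[OF assms(1)])
  with p show ?thesis
    by force
qed

end
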